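(* Let $X$ be a real normed space, let $f_n,f:X\to\mathbb{R}\cup\{+\infty\}$ ($n\in\mathbb{N}$) be lower semicontinuous functions, let $x\in X$ and $\lambda_x\in(0,+\infty]$. The sequence $(f_n)_n$ is slice convergent to $f$ at $x$ with radius $\lambda_x$ if and only if, for every $x^*\in X^*$, the sequence $(f_n+x^* )_n$ is Wijsman convergent to $f+x^*$ at $x$ with radius $\lambda_x$.
   Context: $\operatorname{epi} f=\{(x,\alpha)\in X\times\mathbb{R}: f(x)\le\alpha\}$, $\operatorname{graph} f=\{(x,\alpha)\in X\times\mathbb{R}: f(x)=\alpha\}$. $B_\lambda(x)$ is the closed ball of radius $\lambda$ centered at $x$ (with $B_0(x)=\{x\}$), and $\delta_S$ is the indicator function of $S$ ($0$ on $S$, $+\infty$ elsewhere). $X^*$ is the topological dual of $X$. $X\times\mathbb{R}$ carries the max norm $\|(x,t)\|=\max\{\|x\|,|t|\}$. For subsets $A,B$ of a normed space, the gap distance is $D(A,B)=\inf\{\|a-b\|: a\in A,\ b\in B\}$ (with $\inf\emptyset=+\infty$). Wijsman convergence at a point: $(f_n)_n$ is Wijsman convergent to $f$ at $x$ with radius $\lambda_x$ if for all $\lambda\in[0,\lambda_x)$ and all $\alpha\in\mathbb{R}$: (i) there is a sequence $x_n\to x$ in $X$ with $f_n(x_n)\to f(x)$; (ii) $D(B_\lambda(x)\times\{\alpha\},\operatorname{epi} f)>0$ implies $\sup_{\delta>0}\liminf_n D(B_{\lambda+\delta}(x)\times\{\alpha\},\operatorname{epi} f_n)>0$. Slice convergence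 at a point: $(f_n)_n$ is slice convergent to $f$ at $x$ with radius $\lambda_x$ if for every continuous affine $\varphi:X\to\mathbb{R}$ and every $\lambda\in[0,\lambda_x)$, writing $\varphi_\mu:=\varphi+\delta_{B_\mu(x)}$ for $\mu\ge0$: (i) there is a sequence $x_n\to x$ in $X$ with $f_n(x_n)\to f(x)$; (ii) $D(\operatorname{graph}\varphi_\lambda,\operatorname{epi} f)>0$ implies $\sup_{\delta>0}\liminf_n D(\operatorname{graph}\varphi_{\lambda+\delta},\operatorname{epi} f_n)>0$. *)

theory Defs
  imports "HOL-Analysis.Analysis"
begin

text \<open>Functions into \<open>\<real> \<union> {+\<infinity>}\<close> are \<^typ>\<open>ereal\<close>-valued functions that omit the value \<open>-\<infinity>\<close>;
  this is a hypothesis of the theorem and not part of the definitions below.\<close>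

definition lower_semicontinuous :: "('a::topological_space \<Rightarrow> ereal) \<Rightarrow> bool" where
  "lower_semicontinuous f \<longleftrightarrow> (\<forall>x. f x \<le> Liminf (at x) f)"

definition epi :: "('a \<Rightarrow> ereal) \<Rightarrow> ('a \<times> real) set" where
  "epi f = {(x, \<alpha>). f x \<le> ereal \<alpha>}"

definition graph :: "('a \<Rightarrow> ereal) \<Rightarrow> ('a \<times> real) set" where
  "graph f = {(x, \<alpha>). f x = ereal \<alpha>}"

definition indicator_fn :: "'a set \<Rightarrow> 'a \<Rightarrow> ereal" where
  "indicator_fn S x = (if x \<in> S then 0 else \<infinity>)"

text \<open>The library norm on a product type is the Euclidean combination of the two norms, so the
  max norm on \<open>X \<times> \<real>\<close> is introduced separately.\<close>

definition max_norm :: "'a::real_normed_vector \<times> real \<Rightarrow> real" where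
  "max_norm p = max (norm (fst p)) \<bar>snd p\<bar>"

text \<open>The gap distance is \<^typ>\<open>ereal\<close>-valued, so that it is \<open>+\<infinity>\<close> when one of the sets is empty
  (the library's \<^const>\<open>setdist\<close> is \<open>0\<close> in that case).\<close>

definition gap_dist :: "('a::real_normed_vector \<times> real) set \<Rightarrow> ('a \<times> real) set \<Rightarrow> ereal" where
  "gap_dist A B = (INF (a, b)\<in>A \<times> B. ereal (max_norm (a - b)))"

definition affine_fn :: "('a::real_vector \<Rightarrow> real) \<Rightarrow> bool" where
  "affine_fn \<phi> \<longleftrightarrow> (\<forall>u v t. \<phi> ((1 - t) *\<^sub>R u + t *\<^sub>R v) = (1 - t) * \<phi> u + t * \<phi> v)"

definition restrict_ball :: "('a::metric_space \<Rightarrow> real) \<Rightarrow> 'a \<Rightarrow> real \<Rightarrow> 'a \<Rightarrow> ereal" where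
  "restrict_ball \<phi> x \<mu> = (\<lambda>y. ereal (\<phi> y) + indicator_fn (cball x \<mu>) y)"

definition wijsman_convergent_at ::
    "(nat \<Rightarrow> 'a::real_normed_vector \<Rightarrow> ereal) \<Rightarrow> ('a \<Rightarrow> ereal) \<Rightarrow> 'a \<Rightarrow> ereal \<Rightarrow> bool" where
  "wijsman_convergent_at fn f x r \<longleftrightarrow>
    (\<forall>l::real. \<forall>\<alpha>::real. 0 \<le> l \<and> ereal l < r \<longrightarrow>
      (\<exists>xs. xs \<longlonglongrightarrow> x \<and> (\<lambda>n. fn n (xs n)) \<longlonglongrightarrow> f x) \<and>
      (gap_dist (cball x l \<times> {\<alpha>}) (epi f) > 0 \<longrightarrow>
        (SUP \<delta>\<in>{0<..}. liminf (\<lambda>n. gap_dist (cball x (l + \<delta>) \<times> {\<alpha>}) (epi (fn n)))) > 0))"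

definition slice_convergent_at ::
    "(nat \<Rightarrow> 'a::real_normed_vector \<Rightarrow> ereal) \<Rightarrow> ('a \<Rightarrow> ereal) \<Rightarrow> 'a \<Rightarrow> ereal \<Rightarrow> bool" where
  "slice_convergent_at fn f x r \<longleftrightarrow>
    (\<forall>\<phi>. \<forall>l::real. continuous_on UNIV \<phi> \<and> affine_fn \<phi> \<and> 0 \<le> l \<and> ereal l < r \<longrightarrow>
      (\<exists>xs. xs \<longlonglongrightarrow> x \<and> (\<lambda>n. fn n (xs n)) \<longlonglongrightarrow> f x) \<and>
      (gap_dist (graph (restrict_ball \<phi> x l)) (epi f) > 0 \<longrightarrow>
        (SUP \<delta>\<in>{0<..}. liminf (\<lambda>n. gap_dist (graph (restrict_ball \<phi> x (l + \<delta>))) (epi (fn n)))) > 0))"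

end

theory Submission
  imports Defs
begin

text \<open>
  Adding a continuous linear functional \<open>L\<close> to a function shears its epigraph: the map
  \<open>(y, t) \<mapsto> (y, t + L y)\<close> carries \<open>epi f\<close> onto \<open>epi (f + L)\<close>, and it carries the piece of the
  graph of the affine function \<open>\<alpha> - L\<close> lying over a ball onto the horizontal slab
  \<open>cball x l \<times> {\<alpha>}\<close> (lemmas \<open>shear_epi\<close> and \<open>shear_graph_restrict_ball\<close>). So the gaps between
  slabs and \<open>epi (f + L)\<close> in Wijsman convergence are gaps between the sheared copies of the two
  sets that slice convergence of \<open>f\<close> compares for the function \<open>\<alpha> - L\<close>.

  For the max norm the shear by \<open>L\<close> is Lipschitz with constant \<open>1 + norm L\<close>, and its inverse, the shear by \<open>-L\<close>,
  has the same constant. Gap distances before and after shearing are therefore comparable up to a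
  fixed positive factor (\<open>gap_dist_shear_le\<close> and \<open>gap_dist_le_shear\<close>). Both sides of condition (ii)
  only ask whether something is positive, which such a factor does not affect, even under
  \<open>liminf\<close> and \<open>sup\<close>. Condition (i) is the same for \<open>f\<close> and \<open>f + L\<close>, since \<open>L\<close> is continuous
  and real-valued. Finally, the functions \<open>\<alpha> - L\<close> exhaust the continuous affine functions
  (\<open>continuous_affine_iff\<close>), so letting \<open>L\<close> and \<open>\<alpha>\<close> range over everything on the Wijsman side
  covers exactly the test functions of slice convergence.
\<close>

section \<open>Continuous affine functions\<close>

text \<open>Continuity at \<open>0\<close> gives a ball of some radius \<open>d\<close> on which \<open>g\<close> is smaller than \<open>1\<close>; rescaling
  a nonzero vector to norm \<open>d / 2\<close> then yields the operator bound \<open>2 / d\<close>.\<close>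

lemma continuous_linear_imp_bounded_linear:
  fixes g :: "'a::real_normed_vector \<Rightarrow> real"
  assumes "linear g" and "continuous_on UNIV g"
  shows "bounded_linear g"
proof -
  interpret linear g by fact
  have "isCont g 0"
    using assms(2) by (simp add: continuous_on_eq_continuous_at)
  then obtain d where d: "d > 0" "\<And>y. norm y < d \<Longrightarrow> \<bar>g y\<bar> < 1"
    unfolding continuous_at_eps_delta by (metis dist_0_norm dist_commute dist_real_def
        diff_zero zero zero_less_one)
  have "\<bar>g y\<bar> \<le> norm y * (2 / d)" for y
  proof (cases "y = 0")
    case True
    then show ?thesis by (simp add: zero)
  next
    case False
    then have ny: "norm y > 0" by simp
    have "\<bar>g ((d / (2 * norm y)) *\<^sub>R y)\<bar> < 1"
      using d(1) ny by (intro d(2)) simp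
    then have "d / (2 * norm y) * \<bar>g y\<bar> < 1"
      using d(1) by (simp add: scale abs_mult)
    then show ?thesis
      using d(1) ny by (simp add: field_simps)
  qed
  then show ?thesis
    using assms(1) by (intro bounded_linear.intro bounded_linear_axioms.intro exI[of _ "2 / d"]) auto
qed

text \<open>Subtracting its value at \<open>0\<close> turns an affine function into a linear one: the segments
  from \<open>0\<close> give homogeneity, and \<open>u + v\<close> is twice the midpoint of \<open>u\<close> and \<open>v\<close>.\<close>

lemma affine_fn_imp_linear:
  assumes "affine_fn \<phi>"
  shows "linear (\<lambda>y. \<phi> y - \<phi> 0)"
proof -
  have aff: "\<phi> ((1 - t) *\<^sub>R u + t *\<^sub>R v) = (1 - t) * \<phi> u + t * \<phi> v" for u v t
    using assms by (simp add: affine_fn_def)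
  have scale: "\<phi> (c *\<^sub>R y) - \<phi> 0 = c * (\<phi> y - \<phi> 0)" for c y
    using aff[of c 0 y] by (simp add: algebra_simps)
  show ?thesis
  proof (rule linearI)
    fix u v
    have "\<phi> (2 *\<^sub>R ((1 / 2) *\<^sub>R u + (1 / 2) *\<^sub>R v)) - \<phi> 0
        = 2 * (\<phi> ((1 / 2) *\<^sub>R u + (1 / 2) *\<^sub>R v) - \<phi> 0)"
      by (rule scale)
    moreover have "\<phi> ((1 / 2) *\<^sub>R u + (1 / 2) *\<^sub>R v) = (\<phi> u + \<phi> v) / 2"
      using aff[of "1 / 2" u v] by simp
    ultimately show "\<phi> (u + v) - \<phi> 0 = (\<phi> u - \<phi> 0) + (\<phi> v - \<phi> 0)"
      by (simp add: scaleR_add_right)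
  qed (simp add: scale)
qed

lemma continuous_affine_iff:
  fixes \<phi> :: "'a::real_normed_vector \<Rightarrow> real"
  shows "continuous_on UNIV \<phi> \<and> affine_fn \<phi> \<longleftrightarrow>
    (\<exists>L :: 'a \<Rightarrow>\<^sub>L real. \<exists>\<alpha>. \<phi> = (\<lambda>y. \<alpha> - blinfun_apply L y))"
proof
  assume \<phi>: "continuous_on UNIV \<phi> \<and> affine_fn \<phi>"
  then have "bounded_linear (\<lambda>y. \<phi> y - \<phi> 0)"
    by (intro continuous_linear_imp_bounded_linear affine_fn_imp_linear continuous_intros) auto
  then have "blinfun_apply (- Blinfun (\<lambda>y. \<phi> y - \<phi> 0)) y = \<phi> 0 - \<phi> y" for y
    by (simp add: bounded_linear_Blinfun_apply uminus_blinfun.rep_eq)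
  then have "\<phi> = (\<lambda>y. \<phi> 0 - blinfun_apply (- Blinfun (\<lambda>y. \<phi> y - \<phi> 0)) y)"
    by simp
  then show "\<exists>L :: 'a \<Rightarrow>\<^sub>L real. \<exists>\<alpha>. \<phi> = (\<lambda>y. \<alpha> - blinfun_apply L y)"
    by blast
next
  assume "\<exists>L :: 'a \<Rightarrow>\<^sub>L real. \<exists>\<alpha>. \<phi> = (\<lambda>y. \<alpha> - blinfun_apply L y)"
  then obtain L :: "'a \<Rightarrow>\<^sub>L real" and \<alpha> where "\<phi> = (\<lambda>y. \<alpha> - blinfun_apply L y)"
    by blast
  then show "continuous_on UNIV \<phi> \<and> affine_fn \<phi>"
    by (simp add: affine_fn_def blinfun.add_right blinfun.scaleR_right left_diff_distrib right_diff_distrib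
        continuous_on_diff linear_continuous_on blinfun.bounded_linear_right)
qed

section \<open>Shears and the gap distance\<close>

definition shear :: "('a::real_normed_vector \<Rightarrow>\<^sub>L real) \<Rightarrow> 'a \<times> real \<Rightarrow> 'a \<times> real" where
  "shear L = (\<lambda>(y, t). (y, t + blinfun_apply L y))"

lemma shear_uminus_shear [simp]: "shear (- L) (shear L p) = p"
  by (cases p) (simp add: shear_def uminus_blinfun.rep_eq)

lemma max_norm_shear_diff_le:
  "max_norm (shear L p - shear L q) \<le> (1 + norm L) * max_norm (p - q)"
proof -
  obtain y s z t where pq: "p = (y, s)" "q = (z, t)"
    by (metis surj_pair)
  define m where "m = max_norm (p - q)"
  have m: "norm (y - z) \<le> m" "\<bar>s - t\<bar> \<le> m"
    by (auto simp: m_def max_norm_def pq)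
  have "\<bar>blinfun_apply L (y - z)\<bar> \<le> norm L * norm (y - z)"
    using norm_blinfun[of L "y - z"] by simp
  also have "\<dots> \<le> norm L * m"
    using m(1) by (rule mult_left_mono) simp
  finally have L: "\<bar>blinfun_apply L (y - z)\<bar> \<le> norm L * m" .
  have "0 \<le> norm L * m"
    by (intro mult_nonneg_nonneg norm_ge_zero order_trans[OF norm_ge_zero m(1)])
  then have "norm (y - z) \<le> (1 + norm L) * m"
    using m(1) by (simp add: distrib_right)
  moreover have "\<bar>(s + blinfun_apply L y) - (t + blinfun_apply L z)\<bar> \<le> (1 + norm L) * m"
    using m(2) L unfolding blinfun.diff_right distrib_right by linarith
  ultimately show ?thesis
    by (simp add: m_def[symmetric]) (simp add: max_norm_def shear_def pq)
qed

lemma le_gap_dist_iff: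
  "c \<le> gap_dist A B \<longleftrightarrow> (\<forall>a\<in>A. \<forall>b\<in>B. c \<le> ereal (max_norm (a - b)))"
  by (auto simp: gap_dist_def le_INF_iff)

lemma gap_dist_le:
  assumes "a \<in> A" and "b \<in> B"
  shows "gap_dist A B \<le> ereal (max_norm (a - b))"
  using assms le_gap_dist_iff by blast

text \<open>The factor is moved to the other side of the inequality so that only a lower bound of an
  infimum has to be checked, which also disposes of empty sets.\<close>

lemma gap_dist_shear_le:
  "ereal (1 / (1 + norm L)) * gap_dist (shear L ` A) (shear L ` B) \<le> gap_dist A B"
  unfolding le_gap_dist_iff
proof (intro ballI)
  fix a b assume "a \<in> A" "b \<in> B"
  then have "gap_dist (shear L ` A) (shear L ` B) \<le> ereal (max_norm (shear L a - shear L b))"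
    by (intro gap_dist_le imageI)
  also have "\<dots> \<le> ereal ((1 + norm L) * max_norm (a - b))"
    by (simp add: max_norm_shear_diff_le)
  finally have "ereal (1 / (1 + norm L)) * gap_dist (shear L ` A) (shear L ` B)
      \<le> ereal (1 / (1 + norm L)) * ereal ((1 + norm L) * max_norm (a - b))"
    by (rule ereal_mult_left_mono) simp
  also have "\<dots> = ereal (max_norm (a - b))"
    by (simp add: add_pos_nonneg less_imp_neq[symmetric])
  finally show "ereal (1 / (1 + norm L)) * gap_dist (shear L ` A) (shear L ` B)
      \<le> ereal (max_norm (a - b))" .
qed

lemma gap_dist_le_shear:
  "ereal (1 / (1 + norm L)) * gap_dist A B \<le> gap_dist (shear L ` A) (shear L ` B)"
  using gap_dist_shear_le[of "- L" "shear L ` A" "shear L ` B"] by (simp add: image_image)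

lemma shear_image_eqI:
  assumes "\<And>y t. (y, t) \<in> A \<longleftrightarrow> (y, t + blinfun_apply L y) \<in> B"
  shows "shear L ` A = B"
proof (intro set_eqI iffI)
  fix p assume "p \<in> B"
  moreover obtain y t where "p = (y, t)" by fastforce
  ultimately have "(y, t - blinfun_apply L y) \<in> A" and "p = shear L (y, t - blinfun_apply L y)"
    using assms by (simp_all add: shear_def)
  then show "p \<in> shear L ` A" by blast
qed (use assms in \<open>auto simp: shear_def\<close>)

lemma shear_epi: "shear L ` epi f = epi (\<lambda>y. f y + ereal (blinfun_apply L y))"
proof (rule shear_image_eqI)
  show "(y, t) \<in> epi f \<longleftrightarrow>
      (y, t + blinfun_apply L y) \<in> epi (\<lambda>y. f y + ereal (blinfun_apply L y))" for y t
    by (cases "f y") (auto simp: epi_def)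
qed

lemma shear_graph_restrict_ball:
  "shear L ` graph (restrict_ball (\<lambda>y. \<alpha> - blinfun_apply L y) x l) = cball x l \<times> {\<alpha>}"
  by (rule shear_image_eqI) (auto simp: graph_def restrict_ball_def indicator_fn_def)

section \<open>Invariance of the two convergence conditions\<close>

lemma ereal_mult_le_imp_pos:
  fixes a b :: ereal
  assumes "ereal k * a \<le> b" and "k > 0" and "a > 0"
  shows "b > 0"
  using assms by (metis ereal_less(2) ereal_zero_less_0_iff less_le_trans)

lemma SUP_liminf_pos_mono:
  fixes g h :: "'i \<Rightarrow> nat \<Rightarrow> ereal"
  assumes le: "\<And>i n. ereal k * g i n \<le> h i n" and "k > 0"
    and pos: "(SUP i\<in>I. liminf (g i)) > 0"
  shows "(SUP i\<in>I. liminf (h i)) > 0"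
proof -
  obtain i where i: "i \<in> I" "liminf (g i) > 0"
    using pos by (auto simp: less_SUP_iff)
  have "ereal k * liminf (g i) = liminf (\<lambda>n. ereal k * g i n)"
    using \<open>k > 0\<close> by (simp add: Liminf_ereal_mult_left)
  also have "\<dots> \<le> liminf (h i)"
    by (intro Liminf_mono always_eventually allI le)
  finally have "liminf (h i) > 0"
    using \<open>k > 0\<close> i(2) by (rule ereal_mult_le_imp_pos)
  then show ?thesis
    using i(1) by (auto simp: less_SUP_iff)
qed

lemma gap_condition_shear_iff:
  "(gap_dist (graph (restrict_ball (\<lambda>y. \<alpha> - blinfun_apply L y) x l)) (epi f) > 0 \<longrightarrow>
      (SUP \<delta>\<in>{0<..}. liminf (\<lambda>n. gap_dist
        (graph (restrict_ball (\<lambda>y. \<alpha> - blinfun_apply L y) x (l + \<delta>))) (epi (fn n)))) > 0)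
    \<longleftrightarrow>
   (gap_dist (cball x l \<times> {\<alpha>}) (epi (\<lambda>y. f y + ereal (blinfun_apply L y))) > 0 \<longrightarrow>
      (SUP \<delta>\<in>{0<..}. liminf (\<lambda>n. gap_dist (cball x (l + \<delta>) \<times> {\<alpha>})
        (epi (\<lambda>y. fn n y + ereal (blinfun_apply L y))))) > 0)"
proof -
  define G where "G = (\<lambda>l. graph (restrict_ball (\<lambda>y. \<alpha> - blinfun_apply L y) x l))"
  have slab: "cball x l \<times> {\<alpha>} = shear L ` G l" for l
    by (simp add: G_def shear_graph_restrict_ball)
  have k: "1 / (1 + norm L) > 0"
    by (simp add: add_pos_nonneg)
  have "gap_dist (G l) (epi f) > 0 \<longleftrightarrow> gap_dist (shear L ` G l) (shear L ` epi f) > 0"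
    using ereal_mult_le_imp_pos[OF gap_dist_shear_le k] ereal_mult_le_imp_pos[OF gap_dist_le_shear k]
    by blast
  moreover have "(SUP \<delta>\<in>{0<..}. liminf (\<lambda>n. gap_dist (G (l + \<delta>)) (epi (fn n)))) > 0 \<longleftrightarrow>
      (SUP \<delta>\<in>{0<..}. liminf (\<lambda>n. gap_dist (shear L ` G (l + \<delta>)) (shear L ` epi (fn n)))) > 0"
    by (rule iffI)
      (rule SUP_liminf_pos_mono[OF _ k], rule gap_dist_le_shear, assumption,
       rule SUP_liminf_pos_mono[OF _ k], rule gap_dist_shear_le, assumption)
  ultimately show ?thesis
    unfolding slab shear_epi[symmetric] by (simp only: G_def)
qed

text \<open>One implication suffices for both, because adding \<open>-L\<close> undoes adding \<open>L\<close>.\<close>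

lemma recovery_sequence_add_functional_iff:
  fixes L :: "'a::real_normed_vector \<Rightarrow>\<^sub>L real"
  assumes "xs \<longlonglongrightarrow> x"
  shows "(\<lambda>n. fn n (xs n)) \<longlonglongrightarrow> f x \<longleftrightarrow>
    (\<lambda>n. fn n (xs n) + ereal (blinfun_apply L (xs n))) \<longlonglongrightarrow> f x + ereal (blinfun_apply L x)"
proof -
  have add: "(\<lambda>n. g n + ereal (blinfun_apply M (xs n))) \<longlonglongrightarrow> b + ereal (blinfun_apply M x)"
    if "g \<longlonglongrightarrow> b" for g b and M :: "'a \<Rightarrow>\<^sub>L real"
  proof -
    have "(\<lambda>n. ereal (blinfun_apply M (xs n))) \<longlonglongrightarrow> ereal (blinfun_apply M x)"
      using assms by (intro tendsto_intros)
    with that show ?thesis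
      by (intro tendsto_add_ereal_general) auto
  qed
  have cancel: "a + ereal (blinfun_apply L y) + ereal (blinfun_apply (- L) y) = a" for a y
    by (cases a) (auto simp: uminus_blinfun.rep_eq)
  show ?thesis
    using add[of "\<lambda>n. fn n (xs n)" "f x" L]
      add[of "\<lambda>n. fn n (xs n) + ereal (blinfun_apply L (xs n))" "f x + ereal (blinfun_apply L x)" "- L"]
    unfolding cancel by blast
qed

theorem theorem3p4:
  fixes fn :: "nat \<Rightarrow> 'a::real_normed_vector \<Rightarrow> ereal"
    and f :: "'a \<Rightarrow> ereal"
    and x :: 'a
    and r :: ereal
  assumes "\<And>n y. fn n y \<noteq> -\<infinity>"
    and "\<And>y. f y \<noteq> -\<infinity>"
    and "\<And>n. lower_semicontinuous (fn n)"
    and "lower_semicontinuous f"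
    and "0 < r"
  shows "slice_convergent_at fn f x r \<longleftrightarrow>
    (\<forall>xstar :: 'a \<Rightarrow>\<^sub>L real.
      wijsman_convergent_at (\<lambda>n y. fn n y + ereal (blinfun_apply xstar y))
        (\<lambda>y. f y + ereal (blinfun_apply xstar y)) x r)"
proof -
  define recovery where
    "recovery \<longleftrightarrow> (\<exists>xs. xs \<longlonglongrightarrow> x \<and> (\<lambda>n. fn n (xs n)) \<longlonglongrightarrow> f x)"
  define gap_cond where "gap_cond \<phi> l \<longleftrightarrow>
      (gap_dist (graph (restrict_ball \<phi> x l)) (epi f) > 0 \<longrightarrow>
        (SUP \<delta>\<in>{0<..}. liminf (\<lambda>n. gap_dist (graph (restrict_ball \<phi> x (l + \<delta>))) (epi (fn n)))) > 0)"
    for \<phi> l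
  have slice: "slice_convergent_at fn f x r \<longleftrightarrow>
      (\<forall>\<phi> l. (continuous_on UNIV \<phi> \<and> affine_fn \<phi>) \<and> 0 \<le> l \<and> ereal l < r \<longrightarrow>
        recovery \<and> gap_cond \<phi> l)"
    unfolding slice_convergent_at_def recovery_def gap_cond_def conj_assoc ..
  have recovery: "recovery \<longleftrightarrow> (\<exists>xs. xs \<longlonglongrightarrow> x \<and>
      (\<lambda>n. fn n (xs n) + ereal (blinfun_apply L (xs n))) \<longlonglongrightarrow> f x + ereal (blinfun_apply L x))"
    for L
    unfolding recovery_def using recovery_sequence_add_functional_iff by blast
  have wijsman: "wijsman_convergent_at (\<lambda>n y. fn n y + ereal (blinfun_apply L y))
        (\<lambda>y. f y + ereal (blinfun_apply L y)) x r \<longleftrightarrow>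
      (\<forall>l \<alpha>. 0 \<le> l \<and> ereal l < r \<longrightarrow>
        recovery \<and> gap_cond (\<lambda>y. \<alpha> - blinfun_apply L y) l)" for L
    unfolding wijsman_convergent_at_def gap_cond_def gap_condition_shear_iff recovery[of L] ..
  show ?thesis
    unfolding slice wijsman continuous_affine_iff by blast
qed

end
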